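(* Let $d\ge2$. Suppose that $A,B\subset\mathbb{R}^d$ are bounded star domains with non-tangential star centres $a,b$ respectively. Suppose also that $f:\partial A\to\partial B$ is a biLipschitz surjection. Radially extend $f$ to a function from $\overline A$ to $\overline B$, which we continue to denote by $f$, by defining $$f(x):=\begin{cases} b+\dfrac{|x-a|}{|\psi_A(x)-a|}\,\big(f(\psi_A(x))-b\big), & x\in A\setminus\{a\},\\[2mm] b, & x=a.\end{cases}$$ Then $f:\overline A\to\overline B$ is a biLipschitz surjection.
   Context: For distinct points $x,y\in\mathbb{R}^d$, $L(x,y)$ is the straight line through $x$ and $y$ (infinite in both directions) and $l(x,y)$ is the straight line segment from $x$ to $y$. A domain $A\subset\mathbb{R}^d$ is a star domain if there is $a\in A$ such that $l(a,x)\subset A$ for all $x\in A\setminus\{a\}$; such an $a$ is called a star centre of $A$. If $A$ is a bounded star domain with star centre $a$, then $a$ is a non-tangential star centre if there exist $\theta\in(0,\pi/4)$ and $\epsilon>0$ such that for all points $w,v\in\partial A$ with $0<|w-v|<\epsilon$, the acute angle between the lines $L(a,w)$ and $L(w,v)$ is greater than $\theta$. If $A$ is a bounded star domain with non-tangential star centre $a$ and $x\in A\setminus\{a\}$, then $L(a,x)$ meets $\partial A$ at exactly two points; denote by $\hat x$ the one of these with $x\in l(a,\hat x)$. The map $\psi_A:\overline A\setminus\{a\}\to\partial A$ is defined by $\psi_A(x)=\hat x$ for $x\in A\setminus\{a\}$ and $\psi_A(x)=x$ for $x\in\partial A$. A map $f$ is biLipschitz if there is $\Lambda\ge1$ with $\Lambda^{-1}|x-y|\le|f(x)-f(y)|\le\Lambda|x-y|$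 for all $x,y$ in its domain of definition. *)

theory Defs
  imports "HOL-Analysis.Analysis"
begin

definition star_centre :: "('a::euclidean_space) set \<Rightarrow> 'a \<Rightarrow> bool" where
  "star_centre A a \<longleftrightarrow> a \<in> A \<and> (\<forall>x\<in>A - {a}. closed_segment a x \<subseteq> A)"

definition star_domain :: "('a::euclidean_space) set \<Rightarrow> bool" where
  "star_domain A \<longleftrightarrow> open A \<and> connected A \<and> A \<noteq> {} \<and> (\<exists>a. star_centre A a)"

text \<open>Acute angle, in \<open>[0, pi/2]\<close>, between two lines with nonzero direction vectors \<open>u\<close> and \<open>v\<close>.
  The absolute value makes it independent of the choice of direction vectors.\<close>
definition acute_angle :: "'a::euclidean_space \<Rightarrow> 'a \<Rightarrow> real" where
  "acute_angle u v = arccos (\<bar>u \<bullet> v\<bar> / (norm u * norm v))"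

text \<open>The lines through \<open>a, w\<close> and through \<open>w, v\<close> have directions \<open>w - a\<close> and \<open>v - w\<close>; the former
  is nonzero because \<open>a\<close> lies in the open set \<open>A\<close> and \<open>w\<close> in its frontier.\<close>
definition nontangential_star_centre :: "('a::euclidean_space) set \<Rightarrow> 'a \<Rightarrow> bool" where
  "nontangential_star_centre A a \<longleftrightarrow>
     bounded A \<and> star_domain A \<and> star_centre A a \<and>
     (\<exists>\<theta> \<epsilon>. 0 < \<theta> \<and> \<theta> < pi / 4 \<and> 0 < \<epsilon> \<and>
        (\<forall>w\<in>frontier A. \<forall>v\<in>frontier A.
           0 < dist w v \<and> dist w v < \<epsilon> \<longrightarrow> acute_angle (w - a) (v - w) > \<theta>))"

text \<open>Only meaningful for \<open>x\<close> in \<open>closure A - {a}\<close>, where \<open>a\<close> is a non-tangential star centre of \<open>A\<close>;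
  then the point described by \<open>THE\<close> exists and is unique.\<close>
definition radial_proj :: "('a::euclidean_space) set \<Rightarrow> 'a \<Rightarrow> 'a \<Rightarrow> 'a" where
  "radial_proj A a x =
     (if x \<in> frontier A then x
      else THE y. y \<in> affine hull {a, x} \<inter> frontier A \<and> x \<in> closed_segment a y)"

definition radial_extension ::
  "('a::euclidean_space) set \<Rightarrow> 'a \<Rightarrow> 'a \<Rightarrow> ('a \<Rightarrow> 'a) \<Rightarrow> 'a \<Rightarrow> 'a" where
  "radial_extension A a b f x =
     (if x \<in> frontier A then f x
      else if x = a then b
      else b + (norm (x - a) / norm (radial_proj A a x - a)) *\<^sub>R (f (radial_proj A a x) - b))"

definition bilipschitz_on :: "'a::metric_space set \<Rightarrow> ('a \<Rightarrow> 'b::metric_space) \<Rightarrow> bool" where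
  "bilipschitz_on S f \<longleftrightarrow>
     (\<exists>\<Lambda>\<ge>1. \<forall>x\<in>S. \<forall>y\<in>S. inverse \<Lambda> * dist x y \<le> dist (f x) (f y) \<and> dist (f x) (f y) \<le> \<Lambda> * dist x y)"

end

(*
  In the cone coordinates x = a + s (w - a) with s in [0, 1] and w on the frontier, the distance
  between (s, w) and (t, v) is comparable to |s - t| + s |w - v|.  The radial extension acts as
  (s, w) |-> (s, f w), so it inherits the biLipschitz property of f from this comparison.
  The comparison reduces to the claim that the central projection of the frontier to the unit
  sphere expands distances up to a constant: for nearby points this is the angle condition, for
  the others it is compactness together with injectivity of the projection.
*)
theory Submission imports Defs begin

section \<open>Scaling towards a star centre, and elementary facts on angles and directions\<close>

lemma star_centre_scale:
  assumes "star_centre A a" "x \<in> A" "0 \<le> t" "t \<le> 1"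
  shows "a + t *\<^sub>R (x - a) \<in> A"
proof (cases "x = a")
  case True
  then show ?thesis using assms by simp
next
  case False
  have "a + t *\<^sub>R (x - a) = (1 - t) *\<^sub>R a + t *\<^sub>R x"
    by (simp add: algebra_simps)
  then have "a + t *\<^sub>R (x - a) \<in> closed_segment a x"
    using assms(3,4) by (auto simp: in_segment)
  then show ?thesis
    using False assms(1,2) unfolding star_centre_def by blast
qed

lemma star_centre_scale_closure:
  assumes "star_centre A a" "x \<in> closure A" "0 \<le> t" "t \<le> 1"
  shows "a + t *\<^sub>R (x - a) \<in> closure A"
proof -
  have "(\<lambda>x. a + t *\<^sub>R (x - a)) ` closure A \<subseteq> closure A"
  proof (rule image_closure_subset)
    show "continuous_on (closure A) (\<lambda>x. a + t *\<^sub>R (x - a))"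
      by (intro continuous_intros)
    show "(\<lambda>x. a + t *\<^sub>R (x - a)) ` A \<subseteq> closure A"
      using star_centre_scale[OF assms(1) _ assms(3,4)] closure_subset[of A] by blast
  qed simp
  then show ?thesis using assms(2) by blast
qed

lemma acute_angle_scaleR_self:
  assumes "u \<noteq> 0" "k \<noteq> 0"
  shows "acute_angle u (k *\<^sub>R u) = 0"
  using assms by (simp add: acute_angle_def abs_mult power2_norm_eq_inner[symmetric] power2_eq_square)

text \<open>Replacing \<open>y\<close> by \<open>x\<close> as the length of the second vector costs
  at most \<open>\<bar>y - x\<bar>\<close>, which the reverse triangle inequality bounds by the
  right-hand norm again; hence the factor 2. This turns a difference of directions into a difference
  of points.\<close>

lemma norm_diff_scaled_directions:
  fixes u v :: "'a::real_normed_vector"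
  assumes "norm u = 1" "norm v = 1" "0 \<le> x" "0 \<le> y"
  shows "x * norm (u - v) \<le> 2 * norm (x *\<^sub>R u - y *\<^sub>R v)"
proof -
  have "x * norm (u - v) = norm ((x *\<^sub>R u - y *\<^sub>R v) + (y - x) *\<^sub>R v)"
    using assms(3) by (simp add: algebra_simps flip: norm_scaleR[of x, unfolded abs_of_nonneg[OF assms(3)]])
  also have "\<dots> \<le> norm (x *\<^sub>R u - y *\<^sub>R v) + \<bar>y - x\<bar>"
    by (rule norm_triangle_le) (simp add: assms)
  also have "\<bar>y - x\<bar> \<le> norm (x *\<^sub>R u - y *\<^sub>R v)"
    using norm_triangle_ineq3[of "x *\<^sub>R u" "y *\<^sub>R v"] assms by (simp add: abs_minus_commute)
  finally show ?thesis by simp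
qed

lemma arccos_gt_imp_less_cos:
  assumes "\<theta> < arccos x" "0 \<le> \<theta>" "\<bar>x\<bar> \<le> 1"
  shows "x < cos \<theta>"
proof -
  have "cos (arccos x) < cos \<theta>"
    using assms arccos_bounded[of x] by (intro cos_monotone_0_pi) auto
  then show ?thesis using assms(3) by (simp add: cos_arccos_abs)
qed

section \<open>Frontier points on rays from the centre\<close>

locale nontangential_star =
  fixes A :: "'a::euclidean_space set" and a :: 'a
  assumes nontangential: "nontangential_star_centre A a"
begin

lemma bounded: "bounded A" and opn: "open A" and centre: "star_centre A a"
  using nontangential by (auto simp: nontangential_star_centre_def star_domain_def)

lemma centre_in: "a \<in> A"
  using centre by (simp add: star_centre_def)

lemma frontier_disjoint: "w \<in> frontier A \<Longrightarrow> w \<notin> A"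
  using opn by (simp add: frontier_def interior_open)

lemma frontier_neq_centre: "w \<in> frontier A \<Longrightarrow> w \<noteq> a"
  using frontier_disjoint centre_in by blast

lemma angle_condition:
  obtains \<theta> \<epsilon> where "0 < \<theta>" "\<theta> < pi / 4" "0 < \<epsilon>"
    "\<And>w v. \<lbrakk>w \<in> frontier A; v \<in> frontier A; w \<noteq> v; dist w v < \<epsilon>\<rbrakk>
       \<Longrightarrow> acute_angle (w - a) (v - w) > \<theta>"
  using nontangential unfolding nontangential_star_centre_def by (metis zero_less_dist_iff)

text \<open>The angle condition sees only nearby pairs; star-shapedness brings two distant frontier
  points on one ray within its reach.\<close>

lemma frontier_ray_le:
  assumes w: "w \<in> frontier A" and v: "v \<in> frontier A" and k: "v - a = k *\<^sub>R (w - a)"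
  shows "k \<le> 1"
proof (rule ccontr)
  assume "\<not> k \<le> 1"
  then have k1: "1 < k" by simp
  obtain \<theta> \<epsilon> where \<theta>: "0 < \<theta>" and \<epsilon>: "0 < \<epsilon>"
    and ang: "\<And>w v. \<lbrakk>w \<in> frontier A; v \<in> frontier A; w \<noteq> v; dist w v < \<epsilon>\<rbrakk>
       \<Longrightarrow> acute_angle (w - a) (v - w) > \<theta>"
    using angle_condition by metis
  have wa: "w - a \<noteq> 0" using frontier_neq_centre[OF w] by simp
  \<comment> \<open>Cutting the factor \<open>k\<close> down to \<open>m\<close> keeps
    \<open>z\<close> between \<open>w\<close> and \<open>v\<close> on the ray and within
    \<open>\<epsilon> / 2\<close> of \<open>w\<close>, where the angle condition applies.\<close>
  define m where "m = 1 + min (k - 1) (\<epsilon> / (2 * norm (w - a)))"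
  have m: "1 < m" "m \<le> k" "m - 1 \<le> \<epsilon> / (2 * norm (w - a))"
    using k1 wa \<epsilon> by (auto simp: m_def)
  define z where "z = a + m *\<^sub>R (w - a)"
  \<comment> \<open>The frontier would contain the whole segment from \<open>w\<close> to \<open>v\<close>, making an angle zero with itself.\<close>
  have "z = a + (m / k) *\<^sub>R (v - a)"
    using k1 by (simp add: z_def k)
  moreover have "v \<in> closure A" using v by (simp add: frontier_def)
  ultimately have "z \<in> closure A"
    using star_centre_scale_closure[OF centre, of v "m / k"] m k1 by simp
  \<comment> \<open>Shrinking a point \<open>z\<close> of \<open>A\<close> by \<open>1 / m\<close>
    would put \<open>w\<close> into \<open>A\<close>, but an open set misses its frontier.\<close>
  moreover have "z \<notin> A"
  proof
    assume "z \<in> A"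
    then have "a + (1 / m) *\<^sub>R (z - a) \<in> A"
      using star_centre_scale[OF centre, of z "1 / m"] m by simp
    then show False
      using m frontier_disjoint[OF w] by (simp add: z_def)
  qed
  ultimately have zf: "z \<in> frontier A"
    using opn by (simp add: frontier_def interior_open)
  have zw: "z - w = (m - 1) *\<^sub>R (w - a)"
    by (simp add: z_def algebra_simps)
  have "dist w z = (m - 1) * norm (w - a)"
    using zw m by (simp add: dist_norm norm_minus_commute[of w z])
  also have "\<dots> \<le> \<epsilon> / 2"
    using m(3) wa by (simp add: field_simps)
  finally have "dist w z < \<epsilon>" using \<epsilon> by simp
  moreover have "w \<noteq> z" using zw m wa by auto
  ultimately have "acute_angle (w - a) (z - w) > \<theta>"
    using ang w zf by blast
  then show False
    using \<theta> acute_angle_scaleR_self[OF wa, of "m - 1"] m zw by simp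
qed

text \<open>Exchanging the two points replaces \<open>k\<close> by \<open>1 / k\<close>, so the
  one-sided bound applied twice forces \<open>k = 1\<close>.\<close>

lemma frontier_ray_unique:
  assumes w: "w \<in> frontier A" and v: "v \<in> frontier A"
    and k: "v - a = k *\<^sub>R (w - a)" and k0: "0 < k"
  shows "v = w"
proof -
  have "k \<le> 1" using frontier_ray_le[OF w v k] .
  moreover have "1 / k \<le> 1"
    using frontier_ray_le[OF v w, of "1 / k"] k k0 by simp
  ultimately have "k = 1" using k0 by simp
  then show ?thesis using k by simp
qed

lemma sgn_inj_frontier:
  assumes "w \<in> frontier A" "v \<in> frontier A" "sgn (w - a) = sgn (v - a)"
  shows "v = w"
proof (rule frontier_ray_unique[OF assms(1,2)])
  have wa: "w \<noteq> a" "v \<noteq> a" using assms frontier_neq_centre by auto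
  have "v - a = norm (v - a) *\<^sub>R sgn (v - a)"
    using wa by (simp add: sgn_div_norm)
  also have "\<dots> = (norm (v - a) / norm (w - a)) *\<^sub>R (w - a)"
    unfolding assms(3)[symmetric] by (simp add: sgn_div_norm divide_inverse)
  finally show "v - a = (norm (v - a) / norm (w - a)) *\<^sub>R (w - a)" .
  show "0 < norm (v - a) / norm (w - a)" using wa by simp
qed

lemma compact_frontier: "compact (frontier A)"
  using bounded by (simp add: compact_frontier_bounded)

text \<open>A ball around \<open>a\<close> inside \<open>A\<close> keeps the frontier away from
  \<open>a\<close>; compactness bounds it from outside.\<close>

lemma frontier_norm_bounds:
  obtains r R where "0 < r" "0 < R" "\<And>w. w \<in> frontier A \<Longrightarrow> r \<le> norm (w - a) \<and> norm (w - a) \<le> R"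
proof -
  obtain r where r: "0 < r" "ball a r \<subseteq> A"
    using opn centre_in open_contains_ball by blast
  have "bounded (frontier A)" using compact_frontier compact_imp_bounded by blast
  then obtain R where R: "\<And>w. w \<in> frontier A \<Longrightarrow> norm (w - a) \<le> R"
    using bounded_any_center[of "frontier A" a] by (auto simp: dist_norm norm_minus_commute)
  show thesis
  \<comment> \<open>The maximum with 1 makes the outer bound positive, so that later constants may
    divide by it.\<close>
  proof (rule that[of r "max R 1"])
    fix w assume w: "w \<in> frontier A"
    then have "w \<notin> ball a r" using r frontier_disjoint by blast
    then show "r \<le> norm (w - a) \<and> norm (w - a) \<le> max R 1"
      using R[OF w] by (auto simp: dist_norm norm_minus_commute)
  qed (use r in auto)
qed

section \<open>Expansion of the central projection to the unit sphere\<close>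

text \<open>By the angle condition, \<open>v\<close> has distance at least
  \<open>sin \<theta> * dist w v\<close> from the line through \<open>a\<close> and
  \<open>w\<close>. The point at distance \<open>norm (v - a)\<close> from \<open>a\<close> in the
  direction of \<open>w\<close> lies on that line, and its distance from \<open>v\<close> is
  \<open>norm (v - a)\<close> times the difference of the two directions.\<close>

lemma sgn_expanding_near:
  obtains c \<epsilon> where "0 < c" "0 < \<epsilon>"
    "\<And>w v. \<lbrakk>w \<in> frontier A; v \<in> frontier A; dist w v < \<epsilon>\<rbrakk>
       \<Longrightarrow> c * dist w v \<le> norm (sgn (w - a) - sgn (v - a))"
proof -
  obtain \<theta> \<epsilon> where \<theta>: "0 < \<theta>" "\<theta> < pi / 4" and \<epsilon>: "0 < \<epsilon>"
    and ang: "\<And>w v. \<lbrakk>w \<in> frontier A; v \<in> frontier A; w \<noteq> v; dist w v < \<epsilon>\<rbrakk>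
       \<Longrightarrow> acute_angle (w - a) (v - w) > \<theta>"
    using angle_condition by metis
  obtain R where R: "0 < R" "\<And>w. w \<in> frontier A \<Longrightarrow> norm (w - a) \<le> R"
    using frontier_norm_bounds by metis
  have sin: "0 < sin \<theta>" using \<theta> by (intro sin_gt_zero) auto
  have "sin \<theta> / R * dist w v \<le> norm (sgn (w - a) - sgn (v - a))"
    if w: "w \<in> frontier A" and v: "v \<in> frontier A" and d: "dist w v < \<epsilon>" for w v
  proof (cases "w = v")
    case True
    then show ?thesis by simp
  next
    case False
    define p q e where "p = sgn (w - a)" and "q = sgn (v - a)" and "e = v - w"
    have wa: "w - a \<noteq> 0" "v - a \<noteq> 0" using w v frontier_neq_centre by auto
    have e0: "e \<noteq> 0" using False by (simp add: e_def)
    have p: "norm p = 1" using wa by (simp add: p_def norm_sgn)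
    have "\<bar>(w - a) \<bullet> e\<bar> / (norm (w - a) * norm e) < cos \<theta>"
    proof (rule arccos_gt_imp_less_cos)
      show "\<theta> < arccos (\<bar>(w - a) \<bullet> e\<bar> / (norm (w - a) * norm e))"
        using ang[OF w v False d] by (simp add: acute_angle_def e_def)
      show "\<bar>\<bar>(w - a) \<bullet> e\<bar> / (norm (w - a) * norm e)\<bar> \<le> 1"
        using wa e0 Cauchy_Schwarz_ineq2[of "w - a" e] by simp
    qed (use \<theta> in simp)
    moreover have "p \<bullet> e = (w - a) \<bullet> e / norm (w - a)"
      by (simp add: p_def sgn_div_norm divide_inverse mult.commute)
    ultimately have "\<bar>p \<bullet> e\<bar> / norm e < cos \<theta>"
      by simp
    then have "\<bar>p \<bullet> e\<bar> \<le> cos \<theta> * norm e"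
      using e0 by (simp add: field_simps)
    then have "(p \<bullet> e)\<^sup>2 \<le> (cos \<theta> * norm e)\<^sup>2"
      using abs_le_square_iff[of "p \<bullet> e" "cos \<theta> * norm e"] by simp
    then have "(sin \<theta> * norm e)\<^sup>2 \<le> (norm e)\<^sup>2 - (p \<bullet> e)\<^sup>2"
      by (simp add: power_mult_distrib sin_squared_eq algebra_simps)
    \<comment> \<open>The left side is the squared distance from \<open>e\<close> to the line
      spanned by the unit vector \<open>p\<close>; the gap in the inequality is exactly the square
      of \<open>l + p \<bullet> e\<close>.\<close>
    also have "\<dots> \<le> (norm (e + l *\<^sub>R p))\<^sup>2" for l
    proof -
      have "p \<bullet> p = 1" using p by (simp add: norm_eq_1)
      then have "(norm (e + l *\<^sub>R p))\<^sup>2 - ((norm e)\<^sup>2 - (p \<bullet> e)\<^sup>2) = (l + p \<bullet> e)\<^sup>2"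
        unfolding power2_norm_eq_inner
        by (simp add: inner_add_left inner_add_right inner_commute[of e p]
            power2_eq_square algebra_simps)
      then show ?thesis by (metis diff_ge_0_iff_ge zero_le_power2)
    qed
    finally have "sin \<theta> * norm e \<le> norm (e + l *\<^sub>R p)" for l
      by (rule power2_le_imp_le) simp
    \<comment> \<open>This value of \<open>l\<close> cancels \<open>w - a\<close> and leaves
      \<open>v - a\<close> minus the multiple of \<open>p\<close> of the same length.\<close>
    moreover have "e + (norm (w - a) - norm (v - a)) *\<^sub>R p = norm (v - a) *\<^sub>R (q - p)"
    proof -
      have "norm (w - a) *\<^sub>R p = w - a" "norm (v - a) *\<^sub>R q = v - a"
        using wa by (simp_all add: p_def q_def sgn_div_norm)
      then show ?thesis by (simp add: e_def scaleR_diff_left scaleR_diff_right)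
    qed
    ultimately have "sin \<theta> * norm e \<le> norm (v - a) * norm (q - p)"
      by (metis norm_scaleR abs_norm_cancel)
    also have "\<dots> \<le> R * norm (q - p)"
      using R(2)[OF v] by (intro mult_right_mono) auto
    finally show ?thesis
      using R(1) by (simp add: e_def p_def q_def field_simps dist_norm norm_minus_commute)
  qed
  then show thesis using that[of "sin \<theta> / R" \<epsilon>] sin R(1) \<epsilon> by simp
qed

text \<open>Pairs at distance at least \<open>\<epsilon>\<close> form a compact set, on which the
  difference of directions is continuous and, by injectivity of the projection, positive; its
  minimum serves as \<open>c\<close>.\<close>

lemma sgn_expanding_far:
  assumes "0 < \<epsilon>"
  obtains c where "0 < c"
    "\<And>w v. \<lbrakk>w \<in> frontier A; v \<in> frontier A; \<epsilon> \<le> dist w v\<rbrakk>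
       \<Longrightarrow> c \<le> norm (sgn (w - a) - sgn (v - a))"
proof -
  define S where "S = (frontier A \<times> frontier A) \<inter> {z. \<epsilon> \<le> dist (fst z) (snd z)}"
  define g where "g = (\<lambda>z. norm (sgn (fst z - a) - sgn (snd z - a)))"
  have "closed {z::'a \<times> 'a. \<epsilon> \<le> dist (fst z) (snd z)}"
    by (intro closed_Collect_le continuous_intros)
  then have "compact S"
    unfolding S_def by (intro compact_Int_closed compact_Times compact_frontier)
  moreover have "continuous_on S g"
    unfolding g_def S_def by (intro continuous_intros) (auto dest: frontier_neq_centre)
  moreover have pos: "0 < g z" if "z \<in> S" for z
    using that assms sgn_inj_frontier[of "fst z" "snd z"] by (auto simp: S_def g_def)
  ultimately obtain c where c: "0 < c" "\<And>z. z \<in> S \<Longrightarrow> c \<le> g z"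
  \<comment> \<open>A minimum needs a nonempty set; if there are no far pairs, any positive constant
    serves and 1 is taken.\<close>
  proof (cases "S = {}")
    case False
    then obtain z0 where "z0 \<in> S" "\<And>z. z \<in> S \<Longrightarrow> g z0 \<le> g z"
      using continuous_attains_inf[OF \<open>compact S\<close> _ \<open>continuous_on S g\<close>] by blast
    then show thesis using that pos by blast
  qed (use that[of 1] in simp)
  then show thesis
    using that[of c] unfolding S_def g_def by fastforce
qed

lemma sgn_expanding:
  obtains c where "0 < c"
    "\<And>w v. \<lbrakk>w \<in> frontier A; v \<in> frontier A\<rbrakk>
       \<Longrightarrow> c * dist w v \<le> norm (sgn (w - a) - sgn (v - a))"
proof -
  obtain c1 \<epsilon> where c1: "0 < c1" and \<epsilon>: "0 < \<epsilon>" and near: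
    "\<And>w v. \<lbrakk>w \<in> frontier A; v \<in> frontier A; dist w v < \<epsilon>\<rbrakk>
       \<Longrightarrow> c1 * dist w v \<le> norm (sgn (w - a) - sgn (v - a))"
    using sgn_expanding_near by metis
  obtain c2 where c2: "0 < c2" and far:
    "\<And>w v. \<lbrakk>w \<in> frontier A; v \<in> frontier A; \<epsilon> \<le> dist w v\<rbrakk>
       \<Longrightarrow> c2 \<le> norm (sgn (w - a) - sgn (v - a))"
    using sgn_expanding_far[OF \<epsilon>] by metis
  obtain R where R: "0 < R" "\<And>w. w \<in> frontier A \<Longrightarrow> norm (w - a) \<le> R"
    using frontier_norm_bounds by metis
  \<comment> \<open>Frontier points are at most \<open>2 * R\<close> apart, so dividing
    \<open>c2\<close> by \<open>2 * R\<close> turns the constant bound for far pairs into a linear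
    one.\<close>
  define c where "c = min c1 (c2 / (2 * R))"
  have "c * dist w v \<le> norm (sgn (w - a) - sgn (v - a))"
    if w: "w \<in> frontier A" and v: "v \<in> frontier A" for w v
  proof (cases "dist w v < \<epsilon>")
    case True
    have "c * dist w v \<le> c1 * dist w v"
      by (intro mult_right_mono) (auto simp: c_def)
    then show ?thesis using near[OF w v True] by simp
  next
    case False
    have "dist w v \<le> norm (w - a) + norm (v - a)"
      using dist_triangle2[of w v a] by (simp add: dist_norm)
    then have "dist w v \<le> 2 * R" using R(2)[OF w] R(2)[OF v] by simp
    then have "c * dist w v \<le> c2 / (2 * R) * (2 * R)"
      using R(1) c2 by (intro mult_mono) (auto simp: c_def)
    then show ?thesis using far[OF w v] False R(1) by simp
  qed
  moreover have "0 < c" using c1 c2 R(1) by (simp add: c_def)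
  ultimately show thesis using that by blast
qed

section \<open>Cone coordinates on the closure\<close>

text \<open>Weighting by \<open>s\<close> alone is harmless: using \<open>t\<close> instead changes
  the sum by at most \<open>\<bar>s - t\<bar>\<close> times the diameter of the frontier. The upper
  bound is the triangle inequality; the lower one rests on \<open>sgn_expanding\<close>.\<close>

lemma cone_dist_comparable:
  obtains K where "1 \<le> K"
    "\<And>w v s t. \<lbrakk>w \<in> frontier A; v \<in> frontier A; 0 \<le> s; s \<le> 1; 0 \<le> t; t \<le> 1\<rbrakk>
       \<Longrightarrow> \<bar>s - t\<bar> + s * dist w v \<le> K * dist (a + s *\<^sub>R (w - a)) (a + t *\<^sub>R (v - a))"
    "\<And>w v s t. \<lbrakk>w \<in> frontier A; v \<in> frontier A; 0 \<le> s; s \<le> 1; 0 \<le> t; t \<le> 1\<rbrakk>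
       \<Longrightarrow> dist (a + s *\<^sub>R (w - a)) (a + t *\<^sub>R (v - a)) \<le> K * (\<bar>s - t\<bar> + s * dist w v)"
proof -
  obtain c where c: "0 < c" and exp:
    "\<And>w v. \<lbrakk>w \<in> frontier A; v \<in> frontier A\<rbrakk>
       \<Longrightarrow> c * dist w v \<le> norm (sgn (w - a) - sgn (v - a))"
    using sgn_expanding by metis
  obtain r R where r: "0 < r" "0 < R" "\<And>w. w \<in> frontier A \<Longrightarrow> r \<le> norm (w - a) \<and> norm (w - a) \<le> R"
    using frontier_norm_bounds by metis
  \<comment> \<open>\<open>C\<close> is the factor that bounds \<open>s * dist w v\<close> by the
    distance of the cone points. The two summands of \<open>L\<close> bound the radial term and this
    term respectively.\<close>
  define C where "C = 2 / (r * c)"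
  define L where "L = (1 + C) / r + C"
  define K where "K = max 1 (max R L)"
  have C: "0 < C" using r c by (simp add: C_def)
  have lower: "\<bar>s - t\<bar> + s * dist w v \<le> L * dist (a + s *\<^sub>R (w - a)) (a + t *\<^sub>R (v - a))"
    and upper: "dist (a + s *\<^sub>R (w - a)) (a + t *\<^sub>R (v - a)) \<le> max 1 R * (\<bar>s - t\<bar> + s * dist w v)"
    if w: "w \<in> frontier A" and v: "v \<in> frontier A" and s: "0 \<le> s" and t: "0 \<le> t" for w v s t
  proof -
    define p q where "p = w - a" and "q = v - a"
    have pq: "p \<noteq> 0" "q \<noteq> 0" using w v frontier_neq_centre by (auto simp: p_def q_def)
    define D where "D = norm (s *\<^sub>R p - t *\<^sub>R q)"
    have D: "dist (a + s *\<^sub>R (w - a)) (a + t *\<^sub>R (v - a)) = D"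
      by (simp add: D_def p_def q_def dist_norm)
    have d: "dist w v = norm (p - q)" by (simp add: p_def q_def dist_norm)
    have nq: "r \<le> norm q" "norm q \<le> R" and np: "r \<le> norm p"
      using r(3)[OF v] r(3)[OF w] by (auto simp: p_def q_def)
    \<comment> \<open>Expansion of directions is applied at the radii \<open>s * norm p\<close> and
      \<open>t * norm q\<close> of the two cone points.\<close>
    have "r * (s * (c * dist w v)) \<le> norm p * (s * norm (sgn p - sgn q))"
      using exp[OF w v] np r c s by (intro mult_mono) (auto simp: p_def q_def)
    also have "\<dots> \<le> 2 * norm ((s * norm p) *\<^sub>R sgn p - (t * norm q) *\<^sub>R sgn q)"
      using norm_diff_scaled_directions[of "sgn p" "sgn q" "s * norm p" "t * norm q"] pq s t
      by (simp add: norm_sgn mult_ac)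
    also have "\<dots> = 2 * D" using pq by (simp add: D_def sgn_div_norm field_simps)
    finally have sd: "s * dist w v \<le> C * D"
      using r c by (simp add: C_def field_simps)
    \<comment> \<open>Once the term in \<open>p - q\<close> is under control, this identity isolates
      the radial difference; \<open>norm q\<close> is at least \<open>r\<close>, so it can be
      divided out.\<close>
    have "(s - t) *\<^sub>R q = (s *\<^sub>R p - t *\<^sub>R q) - s *\<^sub>R (p - q)"
      by (simp add: algebra_simps)
    then have "norm ((s - t) *\<^sub>R q) \<le> D + s * dist w v"
      using norm_triangle_ineq4[of "s *\<^sub>R p - t *\<^sub>R q" "s *\<^sub>R (p - q)"] s by (simp add: D_def d)
    then have "\<bar>s - t\<bar> * norm q \<le> (1 + C) * D"
      using sd unfolding norm_scaleR by (simp add: distrib_right)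
    moreover have "\<bar>s - t\<bar> * r \<le> \<bar>s - t\<bar> * norm q"
      using nq by (intro mult_left_mono) auto
    ultimately have "\<bar>s - t\<bar> \<le> (1 + C) / r * D"
      using r by (simp add: field_simps)
    then show "\<bar>s - t\<bar> + s * dist w v \<le> L * dist (a + s *\<^sub>R (w - a)) (a + t *\<^sub>R (v - a))"
      using sd unfolding D L_def by (simp add: distrib_right)
    have "s *\<^sub>R p - t *\<^sub>R q = (s - t) *\<^sub>R q + s *\<^sub>R (p - q)"
      by (simp add: algebra_simps)
    then have "D \<le> \<bar>s - t\<bar> * norm q + s * dist w v"
      using norm_triangle_ineq[of "(s - t) *\<^sub>R q" "s *\<^sub>R (p - q)"] s by (simp add: D_def d)
    also have "\<dots> \<le> \<bar>s - t\<bar> * max 1 R + s * dist w v * max 1 R"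
    proof (intro add_mono)
      show "\<bar>s - t\<bar> * norm q \<le> \<bar>s - t\<bar> * max 1 R"
        using nq by (intro mult_left_mono) auto
      show "s * dist w v \<le> s * dist w v * max 1 R"
        using s mult_left_mono[of 1 "max 1 R" "s * dist w v"] by simp
    qed
    finally show "dist (a + s *\<^sub>R (w - a)) (a + t *\<^sub>R (v - a)) \<le> max 1 R * (\<bar>s - t\<bar> + s * dist w v)"
      unfolding D by (simp add: algebra_simps)
  qed
  show thesis
  proof (rule that[of K])
    show "1 \<le> K" by (simp add: K_def)
    fix w v and s t :: real
    assume *: "w \<in> frontier A" "v \<in> frontier A" "0 \<le> s" "s \<le> 1" "0 \<le> t" "t \<le> 1"
    let ?D = "dist (a + s *\<^sub>R (w - a)) (a + t *\<^sub>R (v - a))"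
    have "L * ?D \<le> K * ?D" by (intro mult_right_mono) (auto simp: K_def)
    then show "\<bar>s - t\<bar> + s * dist w v \<le> K * ?D"
      using lower[of w v s t] * by simp
    have "max 1 R * (\<bar>s - t\<bar> + s * dist w v) \<le> K * (\<bar>s - t\<bar> + s * dist w v)"
      using * by (intro mult_right_mono) (auto simp: K_def)
    then show "?D \<le> K * (\<bar>s - t\<bar> + s * dist w v)"
      using upper[of w v s t] * by simp
  qed
qed

lemma cone_in_closure:
  assumes "w \<in> frontier A" "0 \<le> t" "t \<le> 1"
  shows "a + t *\<^sub>R (w - a) \<in> closure A"
  using star_centre_scale_closure[OF centre _ assms(2,3)] assms(1) by (simp add: frontier_def)

text \<open>The ray from \<open>a\<close> through \<open>x\<close> leaves \<open>A\<close> at a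
  frontier point \<open>a + d *\<^sub>R (x - a)\<close>; once \<open>1 \<le> d\<close> is known, the
  coordinate of \<open>x\<close> is \<open>1 / d\<close>. The centre has coordinate 0 over any
  frontier point.\<close>

lemma closure_cone_cases:
  assumes x: "x \<in> closure A"
  obtains w t where "w \<in> frontier A" "0 \<le> t" "t \<le> 1" "x = a + t *\<^sub>R (w - a)"
proof -
  have int: "a \<in> interior A" using centre_in opn by (simp add: interior_open)
  show thesis
  proof (cases "x = a")
    case True
    obtain l :: 'a where "l \<noteq> 0" using SOME_Basis nonzero_Basis by blast
    then obtain d where "a + d *\<^sub>R l \<in> frontier A"
      using ray_to_frontier[OF bounded int] by metis
    then show thesis using that[of _ 0] True by simp
  next
    case False
    then obtain d where d: "0 < d" and w: "a + d *\<^sub>R (x - a) \<in> frontier A"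
      using ray_to_frontier[OF bounded int, of "x - a"] by auto
    have "1 \<le> d"
    \<comment> \<open>An exit before \<open>x\<close> would make \<open>x\<close> a second frontier
      point on the same ray.\<close>
    proof (rule ccontr)
      assume "\<not> 1 \<le> d"
      then have "x \<notin> A"
        using star_centre_scale[OF centre, of x d] d frontier_disjoint[OF w] by auto
      then have "x \<in> frontier A" using x opn by (simp add: frontier_def interior_open)
      then have "a + d *\<^sub>R (x - a) = x"
        using frontier_ray_unique[of x _ d] w d by simp
      then have "(d - 1) *\<^sub>R (x - a) = 0" by (simp add: algebra_simps)
      then show False using False \<open>\<not> 1 \<le> d\<close> by simp
    qed
    then show thesis
      using that[OF w, of "1 / d"] d by simp
  qed
qed

lemma frontier_cone_unique:
  assumes "w \<in> frontier A" "y \<in> frontier A"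
    and eq: "a + t *\<^sub>R (w - a) = a + s *\<^sub>R (y - a)" and "0 < t" "0 \<le> s"
  shows "y = w"
proof -
  have s: "0 < s"
  proof (rule ccontr)
    assume "\<not> 0 < s"
    then show False using eq assms frontier_neq_centre[of w] by auto
  qed
  have "y - a = (1 / s) *\<^sub>R (s *\<^sub>R (y - a))" using s by simp
  also have "s *\<^sub>R (y - a) = t *\<^sub>R (w - a)" using eq by simp
  also have "(1 / s) *\<^sub>R (t *\<^sub>R (w - a)) = (t / s) *\<^sub>R (w - a)" by simp
  finally show ?thesis
    using frontier_ray_unique[of w y "t / s"] assms s by simp
qed

section \<open>Radial projection and extension in cone coordinates\<close>

lemma radial_proj_cone:
  assumes w: "w \<in> frontier A" and t: "0 < t" "t \<le> 1"
  shows "radial_proj A a (a + t *\<^sub>R (w - a)) = w"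
proof -
  let ?x = "a + t *\<^sub>R (w - a)"
  have seg: "(?x \<in> closed_segment a y) \<longleftrightarrow> (\<exists>s. 0 \<le> s \<and> s \<le> 1 \<and> ?x = a + s *\<^sub>R (y - a))" for y
    by (simp add: in_segment algebra_simps)
  show ?thesis
  proof (cases "?x \<in> frontier A")
    case True
    then have "?x = w" using frontier_cone_unique[OF w True, of t 1] t by simp
    then show ?thesis using True by (simp add: radial_proj_def)
  next
    case False
    have "w = (1 - 1 / t) *\<^sub>R a + (1 / t) *\<^sub>R ?x"
      using t by (simp add: algebra_simps)
    then have "w \<in> affine hull {a, ?x}"
      unfolding affine_hull_2 by (auto intro: exI[of _ "1 - 1 / t"] exI[of _ "1 / t"])
    \<comment> \<open>Any competing \<open>y\<close> exhibits the same point as a cone point over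
      \<open>y\<close>, so \<open>frontier_cone_unique\<close> identifies it with
      \<open>w\<close>.\<close>
    then have "(THE y. y \<in> affine hull {a, ?x} \<inter> frontier A \<and> ?x \<in> closed_segment a y) = w"
      using w t frontier_cone_unique[OF w _ _ t(1)] unfolding seg
      by (intro the_equality) (blast intro: less_imp_le)+
    then show ?thesis using False by (simp add: radial_proj_def)
  qed
qed

text \<open>The quotient of norms in the definition is the coordinate \<open>t\<close>, so the three
  cases merge into one formula: \<open>t\<close> is kept and \<open>w\<close> becomes
  \<open>f w\<close>.\<close>

lemma radial_extension_cone:
  assumes w: "w \<in> frontier A" and t: "0 \<le> t" "t \<le> 1"
  shows "radial_extension A a b f (a + t *\<^sub>R (w - a)) = b + t *\<^sub>R (f w - b)"
proof (cases "t = 0")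
  case True
  then show ?thesis using frontier_neq_centre by (auto simp: radial_extension_def)
next
  case False
  then have t0: "0 < t" using t by simp
  have wa: "w \<noteq> a" using frontier_neq_centre[OF w] .
  show ?thesis
  proof (cases "a + t *\<^sub>R (w - a) \<in> frontier A")
    case True
    then have eq: "a + t *\<^sub>R (w - a) = w"
      using frontier_cone_unique[OF w True, of t 1] t0 by simp
    then have "(t - 1) *\<^sub>R (w - a) = 0" by (simp add: algebra_simps)
    then have "t = 1" using wa by simp
    then show ?thesis using w by (simp add: radial_extension_def)
  next
    case False
    then show ?thesis
      using radial_proj_cone[OF w t0 t(2)] wa t0 by (simp add: radial_extension_def)
  qed
qed

end

section \<open>Transfer of the biLipschitz bounds from the frontiers to the closures\<close>

theorem theorem6:
  fixes A B :: "(real ^ 'd) set" and a b :: "real ^ 'd"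
    and f :: "real ^ 'd \<Rightarrow> real ^ 'd"
  assumes "CARD('d) \<ge> 2"
    and "bounded A" and "star_domain A" and "nontangential_star_centre A a"
    and "bounded B" and "star_domain B" and "nontangential_star_centre B b"
    and "bilipschitz_on (frontier A) f" and "f ` frontier A = frontier B"
  shows "bilipschitz_on (closure A) (radial_extension A a b f) \<and>
         radial_extension A a b f ` closure A = closure B"
proof -
  interpret A: nontangential_star A a by unfold_locales (rule assms)
  interpret B: nontangential_star B b by unfold_locales (rule assms)
  let ?F = "radial_extension A a b f"
  have fB: "f w \<in> frontier B" if "w \<in> frontier A" for w
    using assms(9) that by blast
  obtain \<Lambda> where \<Lambda>: "1 \<le> \<Lambda>"
    and f: "\<And>w v. \<lbrakk>w \<in> frontier A; v \<in> frontier A\<rbrakk>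
        \<Longrightarrow> dist w v \<le> \<Lambda> * dist (f w) (f v) \<and> dist (f w) (f v) \<le> \<Lambda> * dist w v"
    using assms(8) unfolding bilipschitz_on_def by (force simp: field_simps)
  obtain K where K: "1 \<le> K" and
    KA: "\<And>w v s t. \<lbrakk>w \<in> frontier A; v \<in> frontier A; 0 \<le> s; s \<le> 1; 0 \<le> t; t \<le> 1\<rbrakk>
       \<Longrightarrow> \<bar>s - t\<bar> + s * dist w v \<le> K * dist (a + s *\<^sub>R (w - a)) (a + t *\<^sub>R (v - a))"
    "\<And>w v s t. \<lbrakk>w \<in> frontier A; v \<in> frontier A; 0 \<le> s; s \<le> 1; 0 \<le> t; t \<le> 1\<rbrakk>
       \<Longrightarrow> dist (a + s *\<^sub>R (w - a)) (a + t *\<^sub>R (v - a)) \<le> K * (\<bar>s - t\<bar> + s * dist w v)"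
    using A.cone_dist_comparable by blast
  obtain M where M: "1 \<le> M" and
    MB: "\<And>w v s t. \<lbrakk>w \<in> frontier B; v \<in> frontier B; 0 \<le> s; s \<le> 1; 0 \<le> t; t \<le> 1\<rbrakk>
       \<Longrightarrow> \<bar>s - t\<bar> + s * dist w v \<le> M * dist (b + s *\<^sub>R (w - b)) (b + t *\<^sub>R (v - b))"
    "\<And>w v s t. \<lbrakk>w \<in> frontier B; v \<in> frontier B; 0 \<le> s; s \<le> 1; 0 \<le> t; t \<le> 1\<rbrakk>
       \<Longrightarrow> dist (b + s *\<^sub>R (w - b)) (b + t *\<^sub>R (v - b)) \<le> M * (\<bar>s - t\<bar> + s * dist w v)"
    using B.cone_dist_comparable by blast
  \<comment> \<open>Since \<open>1 \<le> \<Lambda>\<close>, the radial term also tolerates the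
    factor. This serves both directions of the bound on \<open>f\<close>.\<close>
  have stretch: "\<bar>s - t\<bar> + s * d \<le> \<Lambda> * (\<bar>s - t\<bar> + s * d')"
    if "0 \<le> s" "d \<le> \<Lambda> * d'" for s t d d' :: real
  proof -
    have "\<bar>s - t\<bar> \<le> \<Lambda> * \<bar>s - t\<bar>" using \<Lambda> mult_right_mono[of 1 \<Lambda> "\<bar>s - t\<bar>"] by simp
    moreover have "s * d \<le> s * (\<Lambda> * d')" using that by (intro mult_left_mono)
    ultimately show ?thesis by (simp add: algebra_simps)
  qed
  \<comment> \<open>One factor for each link: distance to cone expression in \<open>A\<close>,
    passage through \<open>f\<close>, and cone expression to distance in \<open>B\<close>.\<close>
  define N where "N = M * \<Lambda> * K"
  have N: "1 \<le> N"
    unfolding N_def using K M \<Lambda> mult_mono[of 1 "M * \<Lambda>" 1 K] mult_mono[of 1 M 1 \<Lambda>] by simp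
  have "dist x y \<le> N * dist (?F x) (?F y) \<and> dist (?F x) (?F y) \<le> N * dist x y"
    if x: "x \<in> closure A" and y: "y \<in> closure A" for x y
  proof -
    obtain w s where w: "w \<in> frontier A" and s: "0 \<le> s" "s \<le> 1" and xw: "x = a + s *\<^sub>R (w - a)"
      using A.closure_cone_cases[OF x] by blast
    obtain v t where v: "v \<in> frontier A" and t: "0 \<le> t" "t \<le> 1" and yv: "y = a + t *\<^sub>R (v - a)"
      using A.closure_cone_cases[OF y] by blast
    have Fx: "?F x = b + s *\<^sub>R (f w - b)" and Fy: "?F y = b + t *\<^sub>R (f v - b)"
      using A.radial_extension_cone w v s t by (auto simp: xw yv)
    let ?P = "\<bar>s - t\<bar> + s * dist w v" and ?Q = "\<bar>s - t\<bar> + s * dist (f w) (f v)"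
    have PQ: "?P \<le> \<Lambda> * ?Q" "?Q \<le> \<Lambda> * ?P"
      using stretch s(1) f[OF w v] by auto
    have P: "?P \<le> K * dist x y" "dist x y \<le> K * ?P"
      using KA[OF w v s t] by (auto simp: xw yv)
    have Q: "?Q \<le> M * dist (?F x) (?F y)" "dist (?F x) (?F y) \<le> M * ?Q"
      using MB[OF fB[OF w] fB[OF v] s t] by (auto simp: Fx Fy)
    have "dist x y \<le> K * (\<Lambda> * (M * dist (?F x) (?F y)))"
      using P(2) PQ(1) Q(1) K \<Lambda>
      by (meson order_trans mult_left_mono zero_le_one)
    moreover have "dist (?F x) (?F y) \<le> M * (\<Lambda> * (K * dist x y))"
      using Q(2) PQ(2) P(1) M \<Lambda>
      by (meson order_trans mult_left_mono zero_le_one)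
    ultimately show ?thesis by (simp add: N_def mult_ac)
  qed
  then have "bilipschitz_on (closure A) ?F"
    unfolding bilipschitz_on_def using N by (intro exI[of _ N]) (auto simp: field_simps)
  moreover have "?F ` closure A = closure B"
  proof (intro set_eqI iffI)
    fix z assume "z \<in> ?F ` closure A"
    then obtain x where x: "x \<in> closure A" "z = ?F x" by blast
    obtain w s where w: "w \<in> frontier A" "0 \<le> s" "s \<le> 1" "x = a + s *\<^sub>R (w - a)"
      using A.closure_cone_cases[OF x(1)] by blast
    then show "z \<in> closure B"
      using A.radial_extension_cone B.cone_in_closure fB x(2) by simp
  next
    fix z assume "z \<in> closure B"
    then obtain u s where u: "u \<in> frontier B" "0 \<le> s" "s \<le> 1" "z = b + s *\<^sub>R (u - b)"
      using B.closure_cone_cases by blast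
    \<comment> \<open>Surjectivity on the frontier lifts \<open>u\<close> to \<open>w\<close>; the
      same radial coordinate \<open>s\<close> then gives a preimage of \<open>z\<close>.\<close>
    obtain w where w: "w \<in> frontier A" "u = f w" using u(1) assms(9) by blast
    have "z = ?F (a + s *\<^sub>R (w - a))"
      using A.radial_extension_cone[OF w(1) u(2,3)] u(4) w(2) by simp
    then show "z \<in> ?F ` closure A"
      using A.cone_in_closure[OF w(1) u(2,3)] by blast
  qed
  ultimately show ?thesis by blast
qed

end
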